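(* Let $\mu$ be a probability measure on $\mathbb{R}^n$ and $w:\mathbb{R}^n\to[0,\infty)$ a measurable function such that $(\mu,w)$ satisfies Property $(\tau)$ on $\mathbb{R}^n$. Then for every measurable subset $A$ of $\mathbb{R}^n$ and every real number $t>0$, $$\mu\big\{x\in\mathbb{R}^n:\; x\notin A+\{w<t\}\big\}\le \mu(A)^{-1}e^{-t},$$ where $A+\{w<t\}=\{a+y:\ a\in A,\ y\in\mathbb{R}^n,\ w(y)<t\}$ (and $\mu(A)^{-1}=+\infty$ if $\mu(A)=0$).
   Context: Measures on $\mathbb{R}^n$ are Borel and "measurable" means Borel measurable; measures and integrals are taken in the sense of the completion (inf-convolutions of Borel functions, and sums of two Borel sets, are measurable for the completion). For functions $f,g$ on $\mathbb{R}^n$, the inf-convolution is $(f\,\square\, g)(x)=\inf\{f(x-y)+g(y): y\in\mathbb{R}^n\}$. Property $(\tau)$: if $\mu$ is a probability measure on $\mathbb{R}^n$ and $w\ge 0$ a measurable function on $\mathbb{R}^n$, the couple $(\mu,w)$ satisfies Property $(\tau)$ if for every bounded measurable function $\varphi:\mathbb{R}^n\to\mathbb{R}$, $$\Big(\int e^{\varphi\,\square\, w}\,d\mu\Big)\Big(\int e^{-\varphi}\,d\mu\Big)\le 1 .$$ *)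

theory Defs
  imports "HOL-Analysis.Analysis" "HOL-Probability.Probability"
begin

text \<open>The infimum is taken over the reals, so this is the inf-convolution only where the values
  \<open>f (x - y) + g y\<close> are bounded below in \<open>y\<close>. This holds everywhere when \<open>f\<close> is bounded and
  \<open>g \<ge> 0\<close>, as in the uses below.\<close>

definition inf_conv ::
  "(real ^ 'n \<Rightarrow> real) \<Rightarrow> (real ^ 'n \<Rightarrow> real) \<Rightarrow> real ^ 'n \<Rightarrow> real" (infixl "\<box>" 70)
  where "(f \<box> g) x = (INF y. f (x - y) + g y)"

text \<open>\<open>\<phi> \<box> w\<close> need not be Borel, but it is measurable for the completion of \<open>\<mu>\<close>, hence the first
  integral. Both integrands are positive, so the integrals are taken in \<open>[0, \<infinity>]\<close>.\<close>

definition property_tau :: "(real ^ 'n) measure \<Rightarrow> (real ^ 'n \<Rightarrow> real) \<Rightarrow> bool"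
  where "property_tau \<mu> w \<longleftrightarrow>
    (\<forall>\<phi>. \<phi> \<in> borel_measurable borel \<and> bounded (range \<phi>) \<longrightarrow>
      (\<integral>\<^sup>+ x. ennreal (exp ((\<phi> \<box> w) x)) \<partial>completion \<mu>) * (\<integral>\<^sup>+ x. ennreal (exp (- \<phi> x)) \<partial>\<mu>) \<le> 1)"

end

theory Submission
  imports Defs
begin

text \<open>Apply Property \<open>(\<tau>)\<close> to \<open>\<phi>\<close> equal to \<open>0\<close> on \<open>A\<close> and to \<open>t\<close> off \<open>A\<close>. Then \<open>\<phi> \<box> w \<ge> t\<close> off
  \<open>A + {w < t}\<close>: either \<open>x - y \<notin> A\<close> and \<open>\<phi>\<close> contributes \<open>t\<close>, or \<open>x - y \<in> A\<close> and \<open>w y \<ge> t\<close>.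
  No value of \<open>\<phi>\<close> above \<open>t\<close> is needed, so \<open>\<phi>\<close> is bounded and no limit has to be taken.\<close>

theorem lemma4:
  fixes \<mu> :: "(real ^ 'n) measure" and w :: "real ^ 'n \<Rightarrow> real"
    and A :: "(real ^ 'n) set" and t :: real
  assumes "prob_space \<mu>" and "sets \<mu> = sets borel"
    and "w \<in> borel_measurable borel" and "\<And>x. 0 \<le> w x"
    and "property_tau \<mu> w"
    and "A \<in> sets borel" and "t > 0"
  shows "emeasure (completion \<mu>) {x. x \<notin> {a + y |a y. a \<in> A \<and> w y < t}}
           \<le> inverse (emeasure \<mu> A) * ennreal (exp (- t))"
proof -
  interpret prob_space \<mu> by fact
  define B where "B = {x. x \<notin> {a + y |a y. a \<in> A \<and> w y < t}}"
  define \<phi> where "\<phi> x = t * indicator (- A) x" for x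
  let ?b = "emeasure (completion \<mu>) B" and ?a = "emeasure \<mu> A"
  have meas: "\<phi> \<in> borel_measurable borel"
    unfolding \<phi>_def using \<open>A \<in> sets borel\<close> by measurable
  have "bounded (range \<phi>)"
    by (rule finite_imp_bounded, rule finite_subset[of _ "{0, t}"])
       (auto simp: \<phi>_def indicator_def)
  with meas have tau: "(\<integral>\<^sup>+ x. ennreal (exp ((\<phi> \<box> w) x)) \<partial>completion \<mu>) *
      (\<integral>\<^sup>+ x. ennreal (exp (- \<phi> x)) \<partial>\<mu>) \<le> 1"
    using \<open>property_tau \<mu> w\<close> unfolding property_tau_def by blast
  have conv_ge: "t \<le> (\<phi> \<box> w) x" if "x \<in> B" for x
    unfolding inf_conv_def
  proof (rule cINF_greatest)
    fix y
    show "t \<le> \<phi> (x - y) + w y"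
    proof (cases "x - y \<in> A")
      case True
      have "x = (x - y) + y" by simp
      with True that have "\<not> w y < t" unfolding B_def by blast
      with True show ?thesis by (simp add: \<phi>_def)
    next
      case False
      with assms(4)[of y] show ?thesis by (simp add: \<phi>_def)
    qed
  qed simp
  have B_le: "ennreal (exp t) * ?b \<le> (\<integral>\<^sup>+ x. ennreal (exp ((\<phi> \<box> w) x)) \<partial>completion \<mu>)"
  \<comment> \<open>Off the completed sigma-algebra \<open>emeasure\<close> has the default value 0,
    so the left side vanishes.\<close>
  proof (cases "B \<in> sets (completion \<mu>)")
    case True
    then have "ennreal (exp t) * ?b = (\<integral>\<^sup>+ x. ennreal (exp t) * indicator B x \<partial>completion \<mu>)"
      by (simp add: nn_integral_cmult_indicator)
    also have "\<dots> \<le> (\<integral>\<^sup>+ x. ennreal (exp ((\<phi> \<box> w) x)) \<partial>completion \<mu>)"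
      by (rule nn_integral_mono) (auto simp: conv_ge indicator_def intro!: ennreal_leI)
    finally show ?thesis .
  qed (simp add: emeasure_notin_sets)
  have "?a = (\<integral>\<^sup>+ x. indicator A x \<partial>\<mu>)"
    using assms by simp
  \<comment> \<open>\<open>\<phi>\<close> vanishes on \<open>A\<close>, so
    \<open>exp (- \<phi> x)\<close> is 1 there and positive elsewhere.\<close>
  also have "\<dots> \<le> (\<integral>\<^sup>+ x. ennreal (exp (- \<phi> x)) \<partial>\<mu>)"
    by (rule nn_integral_mono) (auto simp: \<phi>_def indicator_def)
  finally have prod_le: "ennreal (exp t) * ?b * ?a \<le> 1"
    using mult_mono[OF B_le] tau by (meson order_trans zero_le)
  have "?b \<le> inverse ?a * ennreal (exp (- t))"
  proof (cases "?a = 0")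
    \<comment> \<open>Here \<open>inverse ?a\<close> is infinite and \<open>exp (- t)\<close> is
      positive, so the right side is infinite.\<close>
    case True
    then show ?thesis by (simp add: ennreal_top_mult)
  next
    case False
    have exp_inv: "ennreal (exp (- t)) * ennreal (exp t) = 1"
      by (simp flip: ennreal_mult exp_add)
    have "?b = inverse ?a * ennreal (exp (- t)) * (ennreal (exp t) * ?b * ?a)"
    proof -
      have "inverse ?a * ennreal (exp (- t)) * (ennreal (exp t) * ?b * ?a)
          = (?a * inverse ?a) * (ennreal (exp (- t)) * ennreal (exp t)) * ?b"
        by (simp only: ac_simps)
      \<comment> \<open>Cancelling in the extended reals takes \<open>?a\<close> nonzero and finite;
        it is finite because \<open>\<mu>\<close> is a probability measure.\<close>
      also have "?a * inverse ?a = 1"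
        using False ennreal_divide_self[of ?a] by (simp add: divide_ennreal_def less_top[symmetric])
      finally show ?thesis using exp_inv by simp
    qed
    also have "\<dots> \<le> inverse ?a * ennreal (exp (- t)) * 1"
      by (intro mult_left_mono prod_le) simp
    finally show ?thesis by simp
  qed
  then show ?thesis unfolding B_def .
qed

end
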